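(* Let $p$ be a prime, $k\ge 1$, $q\ge 1$ integers, $N\in\mathbb{Z}\setminus\{0\}$ and $\theta=p^N$. Let $\mathbf{h}=\{\mathbf{h}_x\}_{x\in V\setminus\{x^0\}}$, $\mathbf{h}_x=(h_{0,x},h_{1,x},\dots,h_{q,x})\in\mathbb{Q}_p^{q+1}$, be a boundary function for the $p$-adic $(q+1)$-state Potts model with coupling constant $N$ on the semi-infinite Cayley tree $\Gamma^k_+$. The measures $\mu^{(n)}_{\mathbf{h}}$, $n=1,2,\dots$, satisfy the compatibility condition $$\sum_{\omega\in\Omega_{W_n}}\mu^{(n)}_{\mathbf{h}}(\sigma_{n-1}\vee\omega)=\mu^{(n-1)}_{\mathbf{h}}(\sigma_{n-1})\quad\text{for all }n\ge 2,\ \sigma_{n-1}\in\Omega_{V_{n-1}},$$ if and only if for every $n\in\mathbb{N}$ and every $x\in W_n$ $$\hat{\mathbf{h}}_x=\prod_{y\in S(x)}\mathbf{F}(\hat{\mathbf{h}}_y;\theta)\qquad(\text{coordinatewise product}),$$ where $\hat{\mathbf{h}}_x=(\hat h_{1,x},\dots,\hat h_{q,x})$ with $\hat h_{i,x}=h_{i,x}/h_{0,x}$, and $\mathbf{F}(\mathbf{x};\theta)=(F_1(\mathbf{x};\theta),\dots,F_q(\mathbf{x};\theta))$ is given by $$F_i(\mathbf{x};\theta)=\frac{(\theta-1)x_i+\sum_{j=1}^{q}x_j+1}{\sum_{j=1}^{q}x_j+\theta},\qquad \mathbf{x}=(x_1,\dots,x_q)\in\mathbb{Q}_p^q,\ 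i=1,\dots,q.$$
   Context: $\Gamma^k_+$ is the semi-infinite Cayley tree of order $k$ with root $x^0$: the root has $k$ neighbours and every other vertex has $k+1$ neighbours. $V$ is its vertex set, $d$ the graph distance, $S(x)$ the set of the $k$ direct successors (children) of $x$, $W_n=\{x\in V: d(x,x^0)=n\}$, $V_n=\bigcup_{m=1}^n W_m$, and $L_n$ is the set of edges $\langle x,y\rangle$ with both endpoints in $V_n$. $\Phi=\{0,1,\dots,q\}$, $\Omega_{V_n}=\Phi^{V_n}$, $\Omega_{W_n}=\Phi^{W_n}$; for $\sigma_{n-1}\in\Omega_{V_{n-1}}$ and $\omega\in\Omega_{W_n}$, $\sigma_{n-1}\vee\omega\in\Omega_{V_n}$ is the configuration equal to $\sigma_{n-1}$ on $V_{n-1}$ and to $\omega$ on $W_n$. The Hamiltonian of the $p$-adic $(q+1)$-state Potts model is $H_n(\sigma)=N\sum_{\langle x,y\rangle\in L_n}\delta_{\sigma(x),\sigma(y)}$ (Kronecker delta), $\sigma\in\Omega_{V_n}$. For a boundary function $\mathbf{h}$, $$\mu^{(n)}_{\mathbf{h}}(\sigma)=\frac{1}{Z_n^{(\mathbf{h})}}\,p^{H_n(\sigma)}\prod_{x\in W_n}h_{\sigma(x),x},\qquad Z_n^{(\mathbf{h})}=\sum_{\sigma\in\Omega_{V_n}}p^{H_n(\sigma)}\prod_{x\in W_n}h_{\sigma(x),x}\in\mathbb{Q}_p.$$ It is understood that $h_{0,x}\ne0$ for all $x$ and $Z_n^{(\mathbf{h})}\ne 0$ for all $n$, so that these expressions make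 sense, and that the equation for $\hat{\mathbf{h}}$ "holds" includes that the denominators occurring in it are nonzero. *)

theory Defs
  imports "HOL-Library.FuncSet" "Berlekamp_Zassenhaus.Finite_Field"
begin

section \<open>The field of p-adic numbers\<close>

subsection \<open>The p-adic absolute value on the rationals\<close>

definition padic_val :: "nat \<Rightarrow> rat \<Rightarrow> int" where
  "padic_val p r = int (multiplicity (int p) (fst (quotient_of r)))
                 - int (multiplicity (int p) (snd (quotient_of r)))"

definition padic_abs :: "nat \<Rightarrow> rat \<Rightarrow> real" where
  "padic_abs p r = (if r = 0 then 0 else real p powi (- padic_val p r))"

lemma padic_val_of_int_divide:
  assumes p: "prime p" and nz: "a \<noteq> 0" "b \<noteq> 0"
  shows "padic_val p (of_int a / of_int b)
       = int (multiplicity (int p) a) - int (multiplicity (int p) b)"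
proof -
  let ?r = "of_int a / of_int b :: rat"
  obtain c d where cd: "quotient_of ?r = (c, d)" by force
  have d: "d > 0" using quotient_of_denom_pos[OF cd] .
  have r: "?r = of_int c / of_int d" using quotient_of_div[OF cd] .
  have "of_int (a * d) = (of_int (c * b) :: rat)"
    using r nz d by (simp add: field_simps)
  then have eq: "a * d = c * b" by (simp only: of_int_eq_iff)
  have c: "c \<noteq> 0" using eq nz d by auto
  have pp: "prime_elem (int p)" using p by simp
  have "multiplicity (int p) a + multiplicity (int p) d
      = multiplicity (int p) c + multiplicity (int p) b"
    using eq prime_elem_multiplicity_mult_distrib[OF pp, of a d]
      prime_elem_multiplicity_mult_distrib[OF pp, of c b] nz c d by auto
  then show ?thesis unfolding padic_val_def cd by simp
qed

lemma rat_fraction: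
  fixes r :: rat
  obtains a b where "r = of_int a / of_int b" "b > (0::int)"
  using quotient_of_div[of r] quotient_of_denom_pos[of r] by (metis surj_pair)

lemma padic_abs_0 [simp]: "padic_abs p 0 = 0"
  by (simp add: padic_abs_def)

lemma padic_abs_nonneg [simp]: "padic_abs p r \<ge> 0"
  by (simp add: padic_abs_def)

lemma padic_abs_pos: "prime p \<Longrightarrow> r \<noteq> 0 \<Longrightarrow> padic_abs p r > 0"
  by (auto simp: padic_abs_def dest: prime_gt_0_nat)

lemma padic_abs_eq_0_iff: "prime p \<Longrightarrow> padic_abs p r = 0 \<longleftrightarrow> r = 0"
  by (metis less_irrefl padic_abs_0 padic_abs_pos)

lemma padic_abs_mult:
  assumes p: "prime p"
  shows "padic_abs p (r * s) = padic_abs p r * padic_abs p s"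
proof (cases "r = 0 \<or> s = 0")
  case False
  obtain a b where r: "r = of_int a / of_int b" "b > (0::int)" by (rule rat_fraction)
  obtain c d where s: "s = of_int c / of_int d" "d > (0::int)" by (rule rat_fraction)
  have nz: "a \<noteq> 0" "b \<noteq> 0" "c \<noteq> 0" "d \<noteq> 0" using False r s by auto
  have pp: "prime_elem (int p)" using p by simp
  have "r * s = of_int (a * c) / of_int (b * d)" using r s by simp
  then have "padic_val p (r * s) = padic_val p r + padic_val p s"
    using nz r s by (simp add: padic_val_of_int_divide[OF p]
        prime_elem_multiplicity_mult_distrib[OF pp] del: of_int_mult)
  moreover have "real p \<noteq> 0" using p by (auto dest: prime_gt_0_nat)
  ultimately show ?thesis using False
    by (simp add: padic_abs_def power_int_add[symmetric])
qed (auto simp: padic_abs_def)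

lemma padic_abs_1 [simp]: "padic_abs p 1 = 1"
  by (simp add: padic_abs_def padic_val_def)

lemma multiplicity_int_minus: "multiplicity (p::int) (- a) = multiplicity p a"
  by (simp add: multiplicity_def)

lemma padic_abs_minus [simp]: "padic_abs p (- r) = padic_abs p r"
  by (auto simp: padic_abs_def padic_val_def rat_uminus_code case_prod_beta multiplicity_int_minus)

lemma padic_abs_inverse:
  assumes p: "prime p"
  shows "padic_abs p (inverse r) = inverse (padic_abs p r)"
proof (cases "r = 0")
  case False
  then have "padic_abs p (inverse r) * padic_abs p r = 1"
    by (simp add: padic_abs_mult[OF p, symmetric])
  then show ?thesis by (metis inverse_unique mult.commute)
qed simp

lemma padic_abs_ultrametric:
  assumes p: "prime p"
  shows "padic_abs p (r + s) \<le> max (padic_abs p r) (padic_abs p s)"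
proof (cases "r = 0 \<or> s = 0 \<or> r + s = 0")
  case True
  then show ?thesis by (auto simp: le_max_iff_disj)
next
  case False
  obtain a b where r: "r = of_int a / of_int b" "b > (0::int)" by (rule rat_fraction)
  obtain c d where s: "s = of_int c / of_int d" "d > (0::int)" by (rule rat_fraction)
  have r': "r = of_int (a * d) / of_int (b * d)" and s': "s = of_int (c * b) / of_int (b * d)"
    using r s by auto
  have rs: "r + s = of_int (a * d + c * b) / of_int (b * d)"
    unfolding r' s' by (simp add: add_divide_distrib)
  have nz: "a * d \<noteq> 0" "c * b \<noteq> 0" "b * d \<noteq> 0" using False r s by auto
  have nz4: "a * d + c * b \<noteq> 0"
  proof
    assume "a * d + c * b = 0"
    with rs have "r + s = 0" by (simp only: of_int_0 div_0)
    with False show False by blast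
  qed
  have unit: "\<not> is_unit (int p)" using p by (auto dest: prime_gt_1_nat)
  let ?m = "min (multiplicity (int p) (a * d)) (multiplicity (int p) (c * b))"
  have "int p ^ ?m dvd a * d + c * b"
    by (intro dvd_add multiplicity_dvd') auto
  then have "?m \<le> multiplicity (int p) (a * d + c * b)"
    using nz4 unit by (intro multiplicity_geI) auto
  then have "min (padic_val p r) (padic_val p s) \<le> padic_val p (r + s)"
    unfolding rs unfolding r' s' padic_val_of_int_divide[OF p nz(1,3)]
      padic_val_of_int_divide[OF p nz(2,3)] padic_val_of_int_divide[OF p nz4 nz(3)]
    by linarith
  moreover have "real p \<ge> 1" using p by (auto dest: prime_gt_0_nat)
  ultimately have "real p powi (- padic_val p (r + s)) \<le> real p powi (- padic_val p r)
      \<or> real p powi (- padic_val p (r + s)) \<le> real p powi (- padic_val p s)"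
    by (metis neg_le_iff_le min_le_iff_disj power_int_increasing)
  then show ?thesis using False by (auto simp: padic_abs_def le_max_iff_disj)
qed

lemma padic_abs_triangle:
  assumes "prime p"
  shows "padic_abs p (r + s) \<le> padic_abs p r + padic_abs p s"
  using padic_abs_ultrametric[OF assms, of r s] padic_abs_nonneg[of p r] padic_abs_nonneg[of p s]
  by linarith

lemma padic_abs_minus_commute: "padic_abs p (r - s) = padic_abs p (s - r)"
  by (metis minus_diff_eq padic_abs_minus)


subsection \<open>Cauchy and null sequences\<close>

definition padic_null :: "nat \<Rightarrow> (nat \<Rightarrow> rat) \<Rightarrow> bool" where
  "padic_null p X \<longleftrightarrow> (\<lambda>n. padic_abs p (X n)) \<longlonglongrightarrow> 0"

definition padic_Cauchy :: "nat \<Rightarrow> (nat \<Rightarrow> rat) \<Rightarrow> bool" where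
  "padic_Cauchy p X \<longleftrightarrow> (\<forall>e>0. \<exists>M. \<forall>m\<ge>M. \<forall>n\<ge>M. padic_abs p (X m - X n) < e)"

lemma padic_null_le:
  assumes "padic_null p X" "eventually (\<lambda>n. padic_abs p (Y n) \<le> b * padic_abs p (X n)) sequentially"
  shows "padic_null p Y"
proof -
  have "(\<lambda>n. b * padic_abs p (X n)) \<longlonglongrightarrow> b * 0"
    using assms(1) unfolding padic_null_def by (intro tendsto_intros)
  then have "(\<lambda>n. b * padic_abs p (X n)) \<longlonglongrightarrow> 0" by simp
  then show ?thesis unfolding padic_null_def
    by (intro tendsto_sandwich[OF _ assms(2) tendsto_const]) auto
qed

lemma padic_null_zero [simp]: "padic_null p (\<lambda>n. 0)"
  by (simp add: padic_null_def)

lemma padic_null_const: "prime p \<Longrightarrow> padic_null p (\<lambda>n. c) \<longleftrightarrow> c = 0"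
  by (auto simp: padic_null_def LIMSEQ_const_iff padic_abs_eq_0_iff)

lemma padic_null_minus: "padic_null p X \<Longrightarrow> padic_null p (\<lambda>n. - X n)"
  by (simp add: padic_null_def)

lemma padic_null_add:
  assumes p: "prime p" and "padic_null p X" "padic_null p Y"
  shows "padic_null p (\<lambda>n. X n + Y n)"
proof -
  have "(\<lambda>n. padic_abs p (X n) + padic_abs p (Y n)) \<longlonglongrightarrow> 0 + 0"
    using assms unfolding padic_null_def by (intro tendsto_intros)
  then have "(\<lambda>n. padic_abs p (X n) + padic_abs p (Y n)) \<longlonglongrightarrow> 0" by simp
  moreover have "eventually (\<lambda>n. padic_abs p (X n + Y n)
      \<le> padic_abs p (X n) + padic_abs p (Y n)) sequentially"
    by (rule always_eventually) (use padic_abs_triangle[OF p] in blast)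
  ultimately show ?thesis unfolding padic_null_def
    by (rule tendsto_sandwich[OF always_eventually[OF allI[OF padic_abs_nonneg]] _ tendsto_const, rotated])
qed

lemma padic_Cauchy_const [simp]: "padic_Cauchy p (\<lambda>n. c)"
  by (simp add: padic_Cauchy_def)

lemma padic_Cauchy_minus: "padic_Cauchy p X \<Longrightarrow> padic_Cauchy p (\<lambda>n. - X n)"
  by (simp only: padic_Cauchy_def minus_diff_minus padic_abs_minus)

lemma padic_Cauchy_add:
  assumes p: "prime p" and "padic_Cauchy p X" "padic_Cauchy p Y"
  shows "padic_Cauchy p (\<lambda>n. X n + Y n)"
  unfolding padic_Cauchy_def
proof (intro allI impI)
  fix e :: real assume e: "e > 0"
  obtain M1 where M1: "\<And>m n. m \<ge> M1 \<Longrightarrow> n \<ge> M1 \<Longrightarrow> padic_abs p (X m - X n) < e"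
    using assms(2) e unfolding padic_Cauchy_def by blast
  obtain M2 where M2: "\<And>m n. m \<ge> M2 \<Longrightarrow> n \<ge> M2 \<Longrightarrow> padic_abs p (Y m - Y n) < e"
    using assms(3) e unfolding padic_Cauchy_def by blast
  have "padic_abs p (X m + Y m - (X n + Y n)) < e"
    if "m \<ge> max M1 M2" "n \<ge> max M1 M2" for m n
    using padic_abs_ultrametric[OF p, of "X m - X n" "Y m - Y n"] M1[of m n] M2[of m n] that
    by (simp add: algebra_simps)
  then show "\<exists>M. \<forall>m\<ge>M. \<forall>n\<ge>M. padic_abs p (X m + Y m - (X n + Y n)) < e" by blast
qed

lemma padic_Cauchy_bounded:
  assumes p: "prime p" and X: "padic_Cauchy p X"
  obtains b where "b > 0" "\<And>n. padic_abs p (X n) \<le> b"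
proof -
  obtain M where M: "\<And>m n. m \<ge> M \<Longrightarrow> n \<ge> M \<Longrightarrow> padic_abs p (X m - X n) < 1"
    using X unfolding padic_Cauchy_def by (meson zero_less_one)
  define B where "B = 1 + (\<Sum>i\<le>M. padic_abs p (X i))"
  have le: "padic_abs p (X n) \<le> B - 1" if "n \<le> M" for n
    unfolding B_def using member_le_sum[of n "{..M}" "\<lambda>i. padic_abs p (X i)"] that by simp
  have "padic_abs p (X n) \<le> B" for n
  proof (cases "n \<le> M")
    case False
    then have "padic_abs p (X n - X M) < 1" using M by simp
    then show ?thesis using padic_abs_triangle[OF p, of "X n - X M" "X M"] le[of M] by simp
  qed (use le in force)
  moreover have "B > 0" unfolding B_def by (simp add: add_pos_nonneg sum_nonneg)
  ultimately show ?thesis using that by blast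
qed

lemma padic_Cauchy_mult:
  assumes p: "prime p" and X: "padic_Cauchy p X" and Y: "padic_Cauchy p Y"
  shows "padic_Cauchy p (\<lambda>n. X n * Y n)"
  unfolding padic_Cauchy_def
proof (intro allI impI)
  fix e :: real assume e: "e > 0"
  obtain a where a: "a > 0" "\<And>n. padic_abs p (X n) \<le> a" using padic_Cauchy_bounded[OF p X] by blast
  obtain b where b: "b > 0" "\<And>n. padic_abs p (Y n) \<le> b" using padic_Cauchy_bounded[OF p Y] by blast
  obtain M1 where M1: "\<And>m n. m \<ge> M1 \<Longrightarrow> n \<ge> M1 \<Longrightarrow> padic_abs p (X m - X n) < e / b"
    using X e b unfolding padic_Cauchy_def by (meson divide_pos_pos)
  obtain M2 where M2: "\<And>m n. m \<ge> M2 \<Longrightarrow> n \<ge> M2 \<Longrightarrow> padic_abs p (Y m - Y n) < e / a"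
    using Y e a unfolding padic_Cauchy_def by (meson divide_pos_pos)
  have "padic_abs p (X m * Y m - X n * Y n) < e"
    if mn: "m \<ge> max M1 M2" "n \<ge> max M1 M2" for m n
  proof -
    have "padic_abs p (X m) * padic_abs p (Y m - Y n) \<le> a * padic_abs p (Y m - Y n)"
      using a by (intro mult_right_mono) auto
    also have "\<dots> < e" using M2[of m n] mn a by (simp add: field_simps)
    finally have 1: "padic_abs p (X m * (Y m - Y n)) < e" by (simp add: padic_abs_mult[OF p])
    have "padic_abs p (X m - X n) * padic_abs p (Y n) \<le> padic_abs p (X m - X n) * b"
      using b by (intro mult_left_mono) auto
    also have "\<dots> < e" using M1[of m n] mn b by (simp add: field_simps)
    finally have 2: "padic_abs p ((X m - X n) * Y n) < e" by (simp add: padic_abs_mult[OF p])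
    have "X m * Y m - X n * Y n = X m * (Y m - Y n) + (X m - X n) * Y n"
      by (simp add: algebra_simps)
    then show ?thesis
      using padic_abs_ultrametric[OF p, of "X m * (Y m - Y n)" "(X m - X n) * Y n"] 1 2 by simp
  qed
  then show "\<exists>M. \<forall>m\<ge>M. \<forall>n\<ge>M. padic_abs p (X m * Y m - X n * Y n) < e" by blast
qed

lemma padic_Cauchy_not_null:
  assumes p: "prime p" and X: "padic_Cauchy p X" and nz: "\<not> padic_null p X"
  obtains b M where "b > 0" "\<And>n. n \<ge> M \<Longrightarrow> padic_abs p (X n) \<ge> b"
proof -
  obtain e where e: "e > 0" "\<And>M. \<exists>n\<ge>M. padic_abs p (X n) \<ge> e"
    using nz unfolding padic_null_def LIMSEQ_iff by (force simp: not_less)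
  obtain M where M: "\<And>m n. m \<ge> M \<Longrightarrow> n \<ge> M \<Longrightarrow> padic_abs p (X m - X n) < e"
    using X e unfolding padic_Cauchy_def by meson
  obtain m where m: "m \<ge> M" "padic_abs p (X m) \<ge> e" using e(2) by blast
  have "padic_abs p (X n) \<ge> e" if "n \<ge> M" for n
    using padic_abs_ultrametric[OF p, of "X m - X n" "X n"] M[OF m(1) that] m(2) by simp
  with e(1) show ?thesis using that by blast
qed

lemma padic_Cauchy_inverse:
  assumes p: "prime p" and X: "padic_Cauchy p X" and nz: "\<not> padic_null p X"
  shows "padic_Cauchy p (\<lambda>n. inverse (X n))"
  unfolding padic_Cauchy_def
proof (intro allI impI)
  fix e :: real assume e: "e > 0"
  obtain b M1 where b: "b > 0" "\<And>n. n \<ge> M1 \<Longrightarrow> padic_abs p (X n) \<ge> b"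
    using padic_Cauchy_not_null[OF p X nz] by blast
  have "e * (b * b) > 0" using e b by simp
  then obtain M2 where M2: "\<And>m n. m \<ge> M2 \<Longrightarrow> n \<ge> M2 \<Longrightarrow> padic_abs p (X m - X n) < e * (b * b)"
    using X unfolding padic_Cauchy_def by meson
  have "padic_abs p (inverse (X m) - inverse (X n)) < e"
    if mn: "m \<ge> max M1 M2" "n \<ge> max M1 M2" for m n
  proof -
    have bm: "padic_abs p (X m) \<ge> b" and bn: "padic_abs p (X n) \<ge> b" using b mn by auto
    then have nzs: "X m \<noteq> 0" "X n \<noteq> 0" using b(1) by auto
    have "inverse (X m) - inverse (X n) = (X n - X m) * inverse (X m * X n)"
      using nzs by (simp add: field_simps)
    then have "padic_abs p (inverse (X m) - inverse (X n))
        = padic_abs p (X m - X n) / (padic_abs p (X m) * padic_abs p (X n))"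
      by (simp add: padic_abs_mult[OF p] padic_abs_inverse[OF p] padic_abs_minus_commute[of p "X n" "X m"]
          divide_inverse)
    also have "\<dots> \<le> padic_abs p (X m - X n) / (b * b)"
      using bm bn b(1) by (intro divide_left_mono mult_mono mult_pos_pos) auto
    also have "\<dots> < e" using M2[of m n] mn b(1) by (simp add: field_simps)
    finally show ?thesis .
  qed
  then show "\<exists>M. \<forall>m\<ge>M. \<forall>n\<ge>M. padic_abs p (inverse (X m) - inverse (X n)) < e" by blast
qed

lemma padic_null_mult:
  assumes p: "prime p" and X: "padic_Cauchy p X" and Y: "padic_null p Y"
  shows "padic_null p (\<lambda>n. X n * Y n)"
proof -
  obtain b where b: "\<And>n. padic_abs p (X n) \<le> b" using padic_Cauchy_bounded[OF p X] by blast
  have "padic_abs p (X n * Y n) \<le> b * padic_abs p (Y n)" for n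
    unfolding padic_abs_mult[OF p] by (rule mult_right_mono[OF b padic_abs_nonneg])
  then show ?thesis by (intro padic_null_le[OF Y, of _ b] always_eventually allI)
qed

lemma padic_null_diff:
  "prime p \<Longrightarrow> padic_null p X \<Longrightarrow> padic_null p Y \<Longrightarrow> padic_null p (\<lambda>n. X n - Y n)"
  using padic_null_add[of p X "\<lambda>n. - Y n"] padic_null_minus[of p Y] by simp


subsection \<open>The completion\<close>

text \<open>
  The prime \<open>p\<close> is carried by the type: \<^typ>\<open>'p::prime_card\<close> is a type with a prime number of
  elements, and \<open>'p padic\<close> is the field of \<open>CARD('p)\<close>-adic numbers, constructed as the
  rational Cauchy sequences with respect to the \<open>p\<close>-adic absolute value modulo null sequences.
\<close>

definition padic_rel :: "'p::prime_card itself \<Rightarrow> (nat \<Rightarrow> rat) \<Rightarrow> (nat \<Rightarrow> rat) \<Rightarrow> bool" where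
  "padic_rel _ X Y \<longleftrightarrow> padic_Cauchy CARD('p) X \<and> padic_Cauchy CARD('p) Y
     \<and> padic_null CARD('p) (\<lambda>n. X n - Y n)"

lemma padic_rel_refl: "padic_Cauchy CARD('p) X \<Longrightarrow> padic_rel TYPE('p::prime_card) X X"
  by (simp add: padic_rel_def)

lemma part_equivp_padic_rel: "part_equivp (padic_rel TYPE('p::prime_card))"
proof (rule part_equivpI)
  show "\<exists>X. padic_rel TYPE('p) X X"
    by (intro exI[of _ "\<lambda>n. 0"] padic_rel_refl) simp
  show "symp (padic_rel TYPE('p))"
  proof (rule sympI)
    fix X Y assume *: "padic_rel TYPE('p) X Y"
    then have "padic_null CARD('p) (\<lambda>n. - (X n - Y n))"
      by (intro padic_null_minus) (simp only: padic_rel_def)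
    with * show "padic_rel TYPE('p) Y X" by (simp add: padic_rel_def)
  qed
  show "transp (padic_rel TYPE('p))"
  proof (rule transpI)
    fix X Y Z assume *: "padic_rel TYPE('p) X Y" "padic_rel TYPE('p) Y Z"
    have "padic_null CARD('p) (\<lambda>n. (X n - Y n) + (Y n - Z n))"
      using * by (intro padic_null_add[OF prime_card]) (simp_all only: padic_rel_def)
    then have "padic_null CARD('p) (\<lambda>n. X n - Z n)" by simp
    with * show "padic_rel TYPE('p) X Z" by (simp only: padic_rel_def simp_thms)
  qed
qed

typedef 'p padic =
  "{C. \<exists>X. padic_rel TYPE('p::prime_card) X X \<and> C = Collect (padic_rel TYPE('p) X)}"
  morphisms class_of_padic padic_of_class
  using padic_rel_refl[OF padic_Cauchy_const] by blast

definition abs_padic :: "(nat \<Rightarrow> rat) \<Rightarrow> 'p::prime_card padic" where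
  "abs_padic X = padic_of_class (Collect (padic_rel TYPE('p) X))"

definition rep_padic :: "'p::prime_card padic \<Rightarrow> nat \<Rightarrow> rat" where
  "rep_padic x = (SOME X. X \<in> class_of_padic x)"

lemma Quotient3_padic:
  "Quotient3 (padic_rel TYPE('p)) (abs_padic :: _ \<Rightarrow> 'p padic) (rep_padic :: 'p::prime_card padic \<Rightarrow> _)"
proof -
  interpret quot_type "padic_rel TYPE('p)" padic_of_class "class_of_padic :: 'p padic \<Rightarrow> _"
  proof
    show "part_equivp (padic_rel TYPE('p))" by (rule part_equivp_padic_rel)
    show "\<exists>X. padic_rel TYPE('p) X X \<and> class_of_padic y = Collect (padic_rel TYPE('p) X)"
      for y :: "'p padic" using class_of_padic[of y] by simp
  qed (simp_all add: class_of_padic_inverse padic_of_class_inverse class_of_padic_inject)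
  have "abs = abs_padic" "rep = rep_padic"
    by (auto simp: fun_eq_iff abs_def rep_def abs_padic_def rep_padic_def)
  then show ?thesis using Quotient by simp
qed

lemma abs_rep_padic [simp]: "abs_padic (rep_padic x) = (x :: 'p::prime_card padic)"
  by (rule Quotient3_abs_rep[OF Quotient3_padic])

lemma Cauchy_rep_padic [simp]: "padic_Cauchy CARD('p) (rep_padic (x :: 'p::prime_card padic))"
  using Quotient3_rep_reflp[OF Quotient3_padic, of x] by (simp add: padic_rel_def)

lemma abs_padic_eq_iff:
  assumes "padic_Cauchy CARD('p) X" "padic_Cauchy CARD('p) Y"
  shows "(abs_padic X :: 'p::prime_card padic) = abs_padic Y \<longleftrightarrow> padic_null CARD('p) (\<lambda>n. X n - Y n)"
  using Quotient3_rel[OF Quotient3_padic[where 'p = 'p], of X Y] padic_rel_refl[OF assms(1)]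
    padic_rel_refl[OF assms(2)] assms by (simp add: padic_rel_def)

lemma padic_null_rep_abs:
  assumes "padic_Cauchy CARD('p) X"
  shows "padic_null CARD('p) (\<lambda>n. rep_padic (abs_padic X :: 'p::prime_card padic) n - X n)"
  using abs_padic_eq_iff[OF Cauchy_rep_padic assms, of "abs_padic X"] by simp

lemma padic_cases:
  obtains X where "x = (abs_padic X :: 'p::prime_card padic)" "padic_Cauchy CARD('p) X"
  using abs_rep_padic[of x] Cauchy_rep_padic[of x] by metis

instantiation padic :: (prime_card) field
begin

definition zero_padic :: "'a padic" where
  "0 = abs_padic (\<lambda>n. 0)"

definition one_padic :: "'a padic" where
  "1 = abs_padic (\<lambda>n. 1)"

definition plus_padic :: "'a padic \<Rightarrow> 'a padic \<Rightarrow> 'a padic" where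
  "x + y = abs_padic (\<lambda>n. rep_padic x n + rep_padic y n)"

definition uminus_padic :: "'a padic \<Rightarrow> 'a padic" where
  "- x = abs_padic (\<lambda>n. - rep_padic x n)"

definition minus_padic :: "'a padic \<Rightarrow> 'a padic \<Rightarrow> 'a padic" where
  "x - y = x + - y" for x y :: "'a padic"

definition times_padic :: "'a padic \<Rightarrow> 'a padic \<Rightarrow> 'a padic" where
  "x * y = abs_padic (\<lambda>n. rep_padic x n * rep_padic y n)"

definition inverse_padic :: "'a padic \<Rightarrow> 'a padic" where
  "inverse x = (if x = 0 then 0 else abs_padic (\<lambda>n. inverse (rep_padic x n)))"

definition divide_padic :: "'a padic \<Rightarrow> 'a padic \<Rightarrow> 'a padic" where
  "x div y = x * inverse y" for x y :: "'a padic"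

lemma plus_abs_padic:
  assumes X: "padic_Cauchy CARD('a) X" and Y: "padic_Cauchy CARD('a) Y"
  shows "abs_padic X + abs_padic Y = (abs_padic (\<lambda>n. X n + Y n) :: 'a padic)"
proof -
  let ?X = "rep_padic (abs_padic X :: 'a padic)" and ?Y = "rep_padic (abs_padic Y :: 'a padic)"
  have "padic_null CARD('a) (\<lambda>n. (?X n - X n) + (?Y n - Y n))"
    by (rule padic_null_add[OF prime_card padic_null_rep_abs[OF X] padic_null_rep_abs[OF Y]])
  then have "padic_null CARD('a) (\<lambda>n. (?X n + ?Y n) - (X n + Y n))"
    unfolding add_diff_add .
  then show ?thesis unfolding plus_padic_def
    by (subst abs_padic_eq_iff) (rule padic_Cauchy_add[OF prime_card] Cauchy_rep_padic X Y | assumption)+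
qed

lemma uminus_abs_padic:
  assumes X: "padic_Cauchy CARD('a) X"
  shows "- abs_padic X = (abs_padic (\<lambda>n. - X n) :: 'a padic)"
proof -
  let ?X = "rep_padic (abs_padic X :: 'a padic)"
  have "padic_null CARD('a) (\<lambda>n. - (?X n - X n))"
    by (rule padic_null_minus[OF padic_null_rep_abs[OF X]])
  then have "padic_null CARD('a) (\<lambda>n. - ?X n - - X n)"
    unfolding minus_diff_minus .
  then show ?thesis unfolding uminus_padic_def
    by (subst abs_padic_eq_iff) (rule padic_Cauchy_minus Cauchy_rep_padic X | assumption)+
qed

lemma times_abs_padic:
  assumes X: "padic_Cauchy CARD('a) X" and Y: "padic_Cauchy CARD('a) Y"
  shows "abs_padic X * abs_padic Y = (abs_padic (\<lambda>n. X n * Y n) :: 'a padic)"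
proof -
  let ?X = "rep_padic (abs_padic X :: 'a padic)" and ?Y = "rep_padic (abs_padic Y :: 'a padic)"
  have "padic_null CARD('a) (\<lambda>n. ?X n * (?Y n - Y n) + Y n * (?X n - X n))"
    by (rule padic_null_add[OF prime_card padic_null_mult[OF prime_card Cauchy_rep_padic padic_null_rep_abs[OF Y]]
          padic_null_mult[OF prime_card Y padic_null_rep_abs[OF X]]])
  moreover have "?X n * (?Y n - Y n) + Y n * (?X n - X n) = ?X n * ?Y n - X n * Y n" for n
    by (simp add: algebra_simps)
  ultimately have "padic_null CARD('a) (\<lambda>n. ?X n * ?Y n - X n * Y n)" by (simp only:)
  then show ?thesis unfolding times_padic_def
    by (subst abs_padic_eq_iff) (rule padic_Cauchy_mult[OF prime_card] Cauchy_rep_padic X Y | assumption)+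
qed

instance
proof
  fix x y z :: "'a padic"
  obtain X where X: "x = abs_padic X" "padic_Cauchy CARD('a) X" by (rule padic_cases)
  obtain Y where Y: "y = abs_padic Y" "padic_Cauchy CARD('a) Y" by (rule padic_cases)
  obtain Z where Z: "z = abs_padic Z" "padic_Cauchy CARD('a) Z" by (rule padic_cases)
  note C = X(2) Y(2) Z(2) padic_Cauchy_add[OF prime_card] padic_Cauchy_mult[OF prime_card]
    padic_Cauchy_minus padic_Cauchy_const
  note op = X(1) Y(1) Z(1) zero_padic_def one_padic_def plus_abs_padic uminus_abs_padic times_abs_padic
  show "x + y + z = x + (y + z)" by (simp only: op C add.assoc)
  show "x + y = y + x" unfolding op(1,2) by (simp only: op(6) C) (simp only: add.commute)
  show "0 + x = x" by (simp only: op C add_0_left)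
  show "- x + x = 0" by (simp only: op C left_minus)
  show "x - y = x + - y" by (rule minus_padic_def)
  show "x * y * z = x * (y * z)" by (simp only: op C mult.assoc)
  show "x * y = y * x" unfolding op(1,2) by (simp only: op(8) C) (simp only: mult.commute)
  show "1 * x = x" by (simp only: op C mult_1_left)
  show "(x + y) * z = x * z + y * z" by (simp only: op C distrib_right)
  have "\<not> padic_null CARD('a) (\<lambda>n. 0 - 1)"
    by (simp only: padic_null_const[OF prime_card])
  then show "(0::'a padic) \<noteq> 1"
    by (simp only: zero_padic_def one_padic_def abs_padic_eq_iff padic_Cauchy_const simp_thms)
  show "inverse x * x = 1" if "x \<noteq> 0"
  proof -
    let ?p = "CARD('a)" and ?X = "rep_padic x"
    have p: "prime ?p" by (rule prime_card)
    have nX: "\<not> padic_null ?p ?X"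
      using that abs_padic_eq_iff[OF Cauchy_rep_padic padic_Cauchy_const, of x 0]
      by (simp add: zero_padic_def)
    obtain b M where b: "b > 0" "\<And>n. n \<ge> M \<Longrightarrow> padic_abs ?p (?X n) \<ge> b"
      using padic_Cauchy_not_null[OF p Cauchy_rep_padic nX] by blast
    have "inverse (?X n) * ?X n - 1 = 0" if "n \<ge> M" for n
      using b(1) b(2)[OF that] by (cases "?X n = 0") auto
    then have null: "padic_null ?p (\<lambda>n. inverse (?X n) * ?X n - 1)"
      by (intro padic_null_le[OF padic_null_zero, of _ _ 1] eventually_sequentiallyI[of M]) simp
    note CI = padic_Cauchy_inverse[OF p Cauchy_rep_padic nX]
    have "inverse x * x = abs_padic (\<lambda>n. inverse (?X n)) * abs_padic ?X"
      using that by (simp add: inverse_padic_def)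
    also have "\<dots> = abs_padic (\<lambda>n. inverse (?X n) * ?X n)"
      by (rule times_abs_padic[OF CI Cauchy_rep_padic])
    also have "\<dots> = abs_padic (\<lambda>n. 1)"
      using null abs_padic_eq_iff[OF padic_Cauchy_mult[OF p CI Cauchy_rep_padic] padic_Cauchy_const]
      by blast
    finally show ?thesis by (simp only: one_padic_def)
  qed
  show "x div y = x * inverse y" by (rule divide_padic_def)
  show "inverse (0::'a padic) = 0" by (simp add: inverse_padic_def)
qed

end

instance padic :: (prime_card) field_char_0
proof
  have eq: "of_nat n = (abs_padic (\<lambda>_. of_nat n) :: 'a padic)" for n
    by (induction n) (simp_all add: zero_padic_def one_padic_def plus_abs_padic)
  show "inj (of_nat :: nat \<Rightarrow> 'a padic)"
  proof (rule injI)
    fix m n assume "of_nat m = (of_nat n :: 'a padic)"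
    then have "padic_null CARD('a) (\<lambda>_. of_nat m - of_nat n)"
      unfolding eq by (simp only: abs_padic_eq_iff padic_Cauchy_const)
    then show "m = n" by (simp add: padic_null_const[OF prime_card])
  qed
qed


section \<open>The semi-infinite Cayley tree\<close>

text \<open>A graph is given by its vertex set \<open>V\<close> and its set \<open>E\<close> of unordered edges; a walk is the list of its
  vertices, so its length is the length of the list minus one.\<close>

definition walk :: "'v set set \<Rightarrow> 'v \<Rightarrow> 'v list \<Rightarrow> 'v \<Rightarrow> bool" where
  "walk E x xs y \<longleftrightarrow> xs \<noteq> [] \<and> hd xs = x \<and> last xs = y \<and> successively (\<lambda>u v. {u, v} \<in> E) xs"

definition graph_dist :: "'v set set \<Rightarrow> 'v \<Rightarrow> 'v \<Rightarrow> nat" where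
  "graph_dist E x y = (LEAST n. \<exists>xs. walk E x xs y \<and> length xs = Suc n)"

definition neighbours :: "'v set set \<Rightarrow> 'v \<Rightarrow> 'v set" where
  "neighbours E x = {y. {x, y} \<in> E}"

definition is_tree :: "'v set \<Rightarrow> 'v set set \<Rightarrow> bool" where
  "is_tree V E \<longleftrightarrow>
     (\<forall>e\<in>E. e \<subseteq> V \<and> card e = 2) \<and>
     (\<forall>x\<in>V. \<forall>y\<in>V. \<exists>xs. walk E x xs y) \<and>
     (\<nexists>x xs y. walk E x xs y \<and> distinct xs \<and> length xs \<ge> 3 \<and> {y, x} \<in> E)"

definition cayley_tree :: "nat \<Rightarrow> 'v set \<Rightarrow> 'v set set \<Rightarrow> 'v \<Rightarrow> bool" where
  "cayley_tree k V E x0 \<longleftrightarrow> is_tree V E \<and> x0 \<in> V \<and> card (neighbours E x0) = k \<and>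
     (\<forall>x\<in>V - {x0}. card (neighbours E x) = k + 1)"

definition successors :: "'v set set \<Rightarrow> 'v \<Rightarrow> 'v \<Rightarrow> 'v set" where
  "successors E x0 x = {y \<in> neighbours E x. graph_dist E y x0 = graph_dist E x x0 + 1}"

definition sphere :: "'v set \<Rightarrow> 'v set set \<Rightarrow> 'v \<Rightarrow> nat \<Rightarrow> 'v set" where
  "sphere V E x0 n = {x \<in> V. graph_dist E x x0 = n}"

text \<open>The union starts at \<open>m = 1\<close>, so the root does not belong to the volume \<open>V\<^sub>n\<close>.\<close>

definition volume :: "'v set \<Rightarrow> 'v set set \<Rightarrow> 'v \<Rightarrow> nat \<Rightarrow> 'v set" where
  "volume V E x0 n = (\<Union>m\<in>{1..n}. sphere V E x0 m)"

definition volume_edges :: "'v set \<Rightarrow> 'v set set \<Rightarrow> 'v \<Rightarrow> nat \<Rightarrow> 'v set set" where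
  "volume_edges V E x0 n = {e \<in> E. e \<subseteq> volume V E x0 n}"


section \<open>The p-adic Potts model\<close>

definition configs :: "nat \<Rightarrow> 'v set \<Rightarrow> ('v \<Rightarrow> nat) set" where
  "configs q A = A \<rightarrow>\<^sub>E {0..q}"

definition hamiltonian ::
  "int \<Rightarrow> 'v set \<Rightarrow> 'v set set \<Rightarrow> 'v \<Rightarrow> nat \<Rightarrow> ('v \<Rightarrow> nat) \<Rightarrow> int" where
  "hamiltonian N V E x0 n \<sigma> =
     N * (\<Sum>e\<in>volume_edges V E x0 n. of_bool (\<exists>x y. e = {x, y} \<and> x \<noteq> y \<and> \<sigma> x = \<sigma> y))"

text \<open>A boundary function is a map \<open>h\<close> with \<open>h x i\<close> standing for \<open>h\<^sub>i\<^sub>,\<^sub>x\<close>; its values at the root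
  and at \<open>i > q\<close> are never used.\<close>

definition gibbs_weight ::
  "int \<Rightarrow> 'v set \<Rightarrow> 'v set set \<Rightarrow> 'v \<Rightarrow> ('v \<Rightarrow> nat \<Rightarrow> 'p::prime_card padic) \<Rightarrow> nat \<Rightarrow> ('v \<Rightarrow> nat)
     \<Rightarrow> 'p padic" where
  "gibbs_weight N V E x0 h n \<sigma> =
     of_nat CARD('p) powi hamiltonian N V E x0 n \<sigma> * (\<Prod>x\<in>sphere V E x0 n. h x (\<sigma> x))"

definition partition_fun ::
  "int \<Rightarrow> nat \<Rightarrow> 'v set \<Rightarrow> 'v set set \<Rightarrow> 'v \<Rightarrow> ('v \<Rightarrow> nat \<Rightarrow> 'p::prime_card padic) \<Rightarrow> nat
     \<Rightarrow> 'p padic" where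
  "partition_fun N q V E x0 h n =
     (\<Sum>\<sigma>\<in>configs q (volume V E x0 n). gibbs_weight N V E x0 h n \<sigma>)"

definition gibbs_measure ::
  "int \<Rightarrow> nat \<Rightarrow> 'v set \<Rightarrow> 'v set set \<Rightarrow> 'v \<Rightarrow> ('v \<Rightarrow> nat \<Rightarrow> 'p::prime_card padic) \<Rightarrow> nat
     \<Rightarrow> ('v \<Rightarrow> nat) \<Rightarrow> 'p padic" where
  "gibbs_measure N q V E x0 h n \<sigma> = gibbs_weight N V E x0 h n \<sigma> / partition_fun N q V E x0 h n"

text \<open>\<open>override_on \<sigma> \<omega> (sphere V E x0 n)\<close> is the configuration \<open>\<sigma> \<or> \<omega>\<close> equal to \<open>\<omega>\<close> on the sphere
  and to \<open>\<sigma>\<close> elsewhere.\<close>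

definition compatible ::
  "int \<Rightarrow> nat \<Rightarrow> 'v set \<Rightarrow> 'v set set \<Rightarrow> 'v \<Rightarrow> ('v \<Rightarrow> nat \<Rightarrow> 'p::prime_card padic) \<Rightarrow> bool" where
  "compatible N q V E x0 h \<longleftrightarrow>
     (\<forall>n\<ge>2. \<forall>\<sigma>\<in>configs q (volume V E x0 (n - 1)).
        (\<Sum>\<omega>\<in>configs q (sphere V E x0 n).
           gibbs_measure N q V E x0 h n (override_on \<sigma> \<omega> (sphere V E x0 n)))
        = gibbs_measure N q V E x0 h (n - 1) \<sigma>)"

definition h_hat :: "('v \<Rightarrow> nat \<Rightarrow> 'a::field) \<Rightarrow> 'v \<Rightarrow> nat \<Rightarrow> 'a" where
  "h_hat h x i = h x i / h x 0"

text \<open>Vectors \<open>(x\<^sub>1, \<dots>, x\<^sub>q)\<close> are functions on \<open>nat\<close> evaluated on \<open>{1..q}\<close> only.\<close>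

definition potts_F :: "nat \<Rightarrow> (nat \<Rightarrow> 'a::field) \<Rightarrow> 'a \<Rightarrow> nat \<Rightarrow> 'a" where
  "potts_F q x \<theta> i = ((\<theta> - 1) * x i + (\<Sum>j=1..q. x j) + 1) / ((\<Sum>j=1..q. x j) + \<theta>)"

end

theory Submission
  imports Defs
begin

text \<open>Summing out the spins on \<open>W\<^sub>n\<close> turns each \<open>y \<in> W\<^sub>n\<close> into a factor
  \<open>G\<^sub>y(i) = \<Sum>\<^sub>j \<theta>\<^bsup>\<delta>(i,j)\<^esup> h\<^sub>j\<^sub>,\<^sub>y\<close>, where \<open>i\<close> is the spin of the parent of \<open>y\<close>. Compatibility
  therefore says that \<open>\<Prod>\<^sub>x \<Prod>\<^sub>y G\<^sub>y(\<sigma>(x))\<close> and \<open>\<Prod>\<^sub>x h\<^bsub>\<sigma>(x),x\<^esub>\<close>, with \<open>x\<close> ranging over \<open>W\<^sub>n\<^sub>-\<^sub>1\<close> and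
  \<open>y\<close> over \<open>S(x)\<close>, are proportional as functions of \<open>\<sigma>\<close>, with the ratio \<open>Z\<^sub>n / Z\<^sub>n\<^sub>-\<^sub>1\<close>.
  Changing \<open>\<sigma>\<close> at a single vertex separates the factors, and \<open>F\<^sub>i\<close> is \<open>G\<^sub>y(i) / G\<^sub>y(0)\<close>.
  Conversely, proportionality alone forces the ratio to be \<open>Z\<^sub>n / Z\<^sub>n\<^sub>-\<^sub>1\<close>, by summing over \<open>\<sigma>\<close>.\<close>

section \<open>Walks and graph distance\<close>

lemma graph_dist_le: "walk E x xs y \<Longrightarrow> length xs = Suc n \<Longrightarrow> graph_dist E x y \<le> n"
  unfolding graph_dist_def by (rule Least_le) blast

text \<open>The \<open>LEAST\<close> in \<open>graph_dist\<close> is attained as soon as some walk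
  exists; a walk is nonempty, so its length is a successor.\<close>

lemma walk_attaining_graph_dist:
  assumes "walk E x xs y"
  obtains ys where "walk E x ys y" "length ys = Suc (graph_dist E x y)"
proof -
  have "length xs = Suc (length xs - 1)" using assms by (cases xs) (auto simp: walk_def)
  then have "\<exists>n ys. walk E x ys y \<and> length ys = Suc n" using assms by blast
  from LeastI_ex[OF this] show ?thesis using that unfolding graph_dist_def by blast
qed

lemma walk_Cons: "{x, y} \<in> E \<Longrightarrow> walk E y xs z \<Longrightarrow> walk E x (x # xs) z"
  by (cases xs) (auto simp: walk_def)

lemma walk_snoc: "walk E x xs y \<Longrightarrow> {y, z} \<in> E \<Longrightarrow> walk E x (xs @ [z]) z"
  by (auto simp: walk_def successively_append_iff)

lemma walk_tl: "walk E x (x # y # xs) z \<Longrightarrow> {x, y} \<in> E \<and> walk E y (y # xs) z"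
  by (auto simp: walk_def)

section \<open>Levels and parents in the rooted tree\<close>

locale potts_tree =
  fixes k :: nat and V :: "'v set" and E :: "'v set set" and x0 :: 'v
  assumes tree: "cayley_tree k V E x0" and k: "k \<ge> 1"
begin

abbreviation level where "level x \<equiv> graph_dist E x x0"
abbreviation S where "S \<equiv> successors E x0"
abbreviation W where "W \<equiv> sphere V E x0"
abbreviation U where "U \<equiv> volume V E x0"

lemma root_in: "x0 \<in> V"
  using tree by (simp add: cayley_tree_def)

lemma edge_subset: "e \<in> E \<Longrightarrow> e \<subseteq> V" and edge_card: "e \<in> E \<Longrightarrow> card e = 2"
  using tree by (auto simp: cayley_tree_def is_tree_def)

lemma edge_in: assumes "{x, y} \<in> E" shows "x \<in> V" "y \<in> V" "x \<noteq> y"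
  using edge_subset[OF assms] edge_card[OF assms] by (auto simp: card_insert_if)

lemma acyclic_walk: "walk E x xs y \<Longrightarrow> distinct xs \<Longrightarrow> length xs \<ge> 3 \<Longrightarrow> {y, x} \<notin> E"
  using tree by (auto simp: cayley_tree_def is_tree_def)

lemma level_walk:
  assumes "x \<in> V"
  obtains xs where "walk E x xs x0" "length xs = Suc (level x)"
proof -
  obtain ys where "walk E x ys x0"
    using tree assms root_in unfolding cayley_tree_def is_tree_def by blast
  then show ?thesis using walk_attaining_graph_dist that by metis
qed

lemma level_root: "level x0 = 0"
  using graph_dist_le[of E x0 "[x0]" x0 0] by (simp add: walk_def)

lemma level_eq_0: assumes "x \<in> V" "level x = 0" shows "x = x0"
proof -
  obtain xs where "walk E x xs x0" "length xs = 1" using level_walk[OF assms(1)] assms(2) by auto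
  then show ?thesis by (auto simp: walk_def length_Suc_conv)
qed

lemma level_edge_le: assumes "{x, y} \<in> E" shows "level x \<le> level y + 1"
proof -
  obtain xs where "walk E y xs x0" "length xs = Suc (level y)"
    using level_walk edge_in[OF assms] by metis
  then show ?thesis using graph_dist_le[OF walk_Cons[OF assms]] by simp
qed

text \<open>The second vertex of a shortest walk to the root serves: the tail of the walk bounds its
  level from above, and \<open>level_edge_le\<close> bounds it from below.\<close>

lemma parent_exists:
  assumes "x \<in> V" "level x = Suc n"
  obtains y where "{y, x} \<in> E" "level y = n"
proof -
  obtain xs where xs: "walk E x xs x0" "length xs = Suc (Suc n)" using level_walk assms by metis
  then obtain y ys where ys: "xs = x # y # ys" "length ys = n"
    by (auto simp: walk_def length_Suc_conv)
  have e: "{x, y} \<in> E" and w: "walk E y (y # ys) x0" using walk_tl xs(1) ys(1) by metis+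
  have "level y \<le> n" using graph_dist_le[OF w] ys by simp
  moreover have "level x \<le> level y + 1" by (rule level_edge_le[OF e])
  ultimately show ?thesis using that[of y] e assms(2) by (simp add: insert_commute)
qed

text \<open>Climb from both vertices towards the root until the two branches meet. Because the path
  never rises above level \<open>m\<close>, it can be closed into a cycle by an edge inside the
  level or by a common child, which is how acyclicity is exploited below.\<close>

lemma walk_below_level:
  assumes "u \<in> V" "v \<in> V" "u \<noteq> v" "level u = m" "level v = m"
  shows "\<exists>xs. walk E u xs v \<and> distinct xs \<and> length xs \<ge> 3 \<and> (\<forall>z\<in>set xs. level z \<le> m)"
  using assms
proof (induction m arbitrary: u v)
  case 0
  then show ?case using level_eq_0 by metis
next
  case (Suc m)
  obtain a where a: "{a, u} \<in> E" "level a = m" using parent_exists[of u] Suc.prems by metis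
  obtain b where b: "{b, v} \<in> E" "level b = m" using parent_exists[of v] Suc.prems by metis
  \<comment> \<open>Equal parents give the path \<open>[u, a, v]\<close>; otherwise the path between
    the parents is extended at both ends, and \<open>u\<close>, \<open>v\<close> are new to it
    because they lie one level higher.\<close>
  have a': "{u, a} \<in> E" using a by (simp add: insert_commute)
  show ?case
  proof (cases "a = b")
    case True
    have "walk E u [u, a, v] v" using a' b True by (simp add: walk_def)
    moreover have "distinct [u, a, v]" using Suc.prems a b True by auto
    ultimately show ?thesis using Suc.prems a by (intro exI[of _ "[u, a, v]"]) auto
  next
    case False
    then obtain xs where xs: "walk E a xs b" "distinct xs" "\<forall>z\<in>set xs. level z \<le> m"
      using Suc.IH[of a b] edge_in a b by blast
    have "walk E u (u # xs @ [v]) v" by (rule walk_Cons[OF a' walk_snoc[OF xs(1) b(1)]])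
    moreover have "u \<notin> set xs" "v \<notin> set xs" using xs(3) Suc.prems by auto
    moreover have "xs \<noteq> []" using xs(1) by (simp add: walk_def)
    then have "length xs \<ge> 1" by (cases xs) auto
    ultimately show ?thesis using Suc.prems xs(2,3)
      by (intro exI[of _ "u # xs @ [v]"]) (auto simp: le_Suc_eq)
  qed
qed

text \<open>An edge within one level would close the path of \<open>walk_below_level\<close> into a
  cycle.\<close>

lemma level_edge_neq: assumes "{x, y} \<in> E" shows "level x \<noteq> level y"
proof
  assume "level x = level y"
  then show False using walk_below_level[of y x] edge_in[OF assms] acyclic_walk assms by metis
qed

text \<open>A path joining two parents of \<open>y\<close> at or below their level misses
  \<open>y\<close>, so going through \<open>y\<close> would close it into a cycle.\<close>

lemma parent_unique:
  assumes "{x, y} \<in> E" "{x', y} \<in> E" "level y = Suc (level x)" "level y = Suc (level x')"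
  shows "x = x'"
proof (rule ccontr)
  assume "x \<noteq> x'"
  then obtain xs where xs: "walk E x xs x'" "distinct xs" "length xs \<ge> 3"
      "\<forall>z\<in>set xs. level z \<le> level x"
    using walk_below_level[of x x' "level x"] edge_in assms by (metis Suc_inject)
  have "y \<notin> set xs" using xs(4) assms(3) by fastforce
  then show False
    using acyclic_walk[OF walk_snoc[OF xs(1) assms(2)]] xs assms(1) by (simp add: insert_commute)
qed

section \<open>Successors, spheres and volumes\<close>

lemma successors_iff: "y \<in> S x \<longleftrightarrow> {x, y} \<in> E \<and> level y = Suc (level x)"
  by (auto simp: successors_def neighbours_def)

lemma finite_neighbours: assumes "x \<in> V" shows "finite (neighbours E x)"
proof -
  \<comment> \<open>Infinite sets have \<open>card\<close> 0, so a positive cardinality forces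
    finiteness; at the root the cardinality is \<open>k\<close>, which is at least 1.\<close>
  have "card (neighbours E x) > 0" using tree assms k by (cases "x = x0") (auto simp: cayley_tree_def)
  then show ?thesis using card_ge_0_finite by blast
qed

lemma finite_successors: "x \<in> V \<Longrightarrow> finite (S x)"
  using finite_neighbours by (simp add: successors_def)

lemma successors_disjoint: "x \<noteq> x' \<Longrightarrow> S x \<inter> S x' = {}"
  using parent_unique successors_iff by blast

lemma sphere_Suc: "W (Suc n) = (\<Union>x\<in>W n. S x)"
proof
  show "W (Suc n) \<subseteq> (\<Union>x\<in>W n. S x)"
  proof
    fix y assume y: "y \<in> W (Suc n)"
    then obtain x where x: "{x, y} \<in> E" "level x = n"
      using parent_exists[of y n] by (auto simp: sphere_def)
    then show "y \<in> (\<Union>x\<in>W n. S x)"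
      using y edge_in(1)[OF x(1)] by (auto simp: sphere_def successors_iff)
  qed
  show "(\<Union>x\<in>W n. S x) \<subseteq> W (Suc n)"
    using edge_in(2) by (auto simp: sphere_def successors_iff)
qed

lemma finite_sphere: "finite (W n)"
proof (induction n)
  case 0
  have "W 0 \<subseteq> {x0}" using level_eq_0 by (auto simp: sphere_def)
  then show ?case using finite_subset by blast
next
  case (Suc n)
  moreover have "finite (S x)" if "x \<in> W n" for x
    using that finite_successors by (simp add: sphere_def)
  ultimately show ?case by (simp add: sphere_Suc)
qed

lemma sphere_minus_root: "n \<ge> 1 \<Longrightarrow> W n \<subseteq> V - {x0}"
  by (auto simp: sphere_def level_root)

lemma volume_iff: "x \<in> U n \<longleftrightarrow> x \<in> V \<and> 1 \<le> level x \<and> level x \<le> n"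
  by (auto simp: volume_def sphere_def)

lemma finite_volume: "finite (U n)"
  by (simp add: volume_def finite_sphere)

lemma volume_Suc: "U (Suc n) = U n \<union> W (Suc n)" and volume_sphere_disjoint: "U n \<inter> W (Suc n) = {}"
  by (auto simp: volume_iff sphere_def)

lemma sphere_subset_volume: "n \<ge> 1 \<Longrightarrow> W n \<subseteq> U n"
  by (auto simp: volume_iff sphere_def)

lemma prod_sphere_Suc: "(\<Prod>y\<in>W (Suc n). f y) = (\<Prod>x\<in>W n. \<Prod>y\<in>S x. f y)"
  unfolding sphere_Suc
  by (rule prod.UNION_disjoint)
     (use finite_sphere finite_successors successors_disjoint in \<open>auto simp: sphere_def\<close>)

section \<open>Edges and energy gained with one more sphere\<close>

lemma volume_edges_Suc:
  assumes "n \<ge> 1"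
  shows "volume_edges V E x0 (Suc n)
    = volume_edges V E x0 n \<union> (\<lambda>(x, y). {x, y}) ` (SIGMA x:W n. S x)" (is "?L = ?R")
proof
  show "?L \<subseteq> ?R"
  proof
    fix e assume "e \<in> ?L"
    then have e: "e \<in> E" "e \<subseteq> U (Suc n)" by (auto simp: volume_edges_def)
    obtain a b where ab: "e = {a, b}" using edge_card[OF e(1)] by (auto simp: card_2_iff)
    have ba: "{b, a} \<in> E" using e ab by (simp add: insert_commute)
    note lev = level_edge_le[of a b] level_edge_le[of b a] level_edge_neq[of a b]
    have V: "a \<in> V" "b \<in> V" "level a \<le> Suc n" "level b \<le> Suc n" "1 \<le> level a" "1 \<le> level b"
      using e(2) ab by (auto simp: volume_iff)
    \<comment> \<open>The levels of adjacent vertices differ by exactly one, so an edge reaching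
      level \<open>Suc n\<close> joins a vertex of \<open>W n\<close> to one of its
      children.\<close>
    consider "level a \<le> n" "level b \<le> n" | "level a = n" "level b = Suc n"
      | "level b = n" "level a = Suc n"
      using lev e(1) ab ba V by fastforce
    then show "e \<in> ?R"
    proof cases
      case 1
      then show ?thesis using e ab V by (auto simp: volume_edges_def volume_iff)
    next
      case 2
      then have "(a, b) \<in> (SIGMA x:W n. S x)" using e ab V by (auto simp: sphere_def successors_iff)
      then show ?thesis using ab by blast
    next
      case 3
      then have "(b, a) \<in> (SIGMA x:W n. S x)" using ba V by (auto simp: sphere_def successors_iff)
      moreover have "e = {b, a}" using ab by blast
      ultimately show ?thesis by blast
    qed
  qed
  \<comment> \<open>With \<open>n \<ge> 1\<close> the sphere \<open>W n\<close> lies in the volume;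
    the root, which forms level 0, does not.\<close>
  show "?R \<subseteq> ?L"
    using assms edge_in by (fastforce simp: volume_edges_def volume_iff sphere_def successors_iff)
qed

lemma hamiltonian_Suc:
  assumes "n \<ge> 1"
  shows "hamiltonian N V E x0 (Suc n) (override_on \<sigma> \<omega> (W (Suc n)))
    = hamiltonian N V E x0 n \<sigma> + N * (\<Sum>x\<in>W n. \<Sum>y\<in>S x. of_bool (\<sigma> x = \<omega> y))"
proof -
  let ?\<tau> = "override_on \<sigma> \<omega> (W (Suc n))" and ?P = "SIGMA x:W n. S x"
  let ?f = "\<lambda>\<tau> e. of_bool (\<exists>x y. e = {x, y} \<and> x \<noteq> y \<and> \<tau> x = \<tau> y) :: int"
  have fin: "finite (volume_edges V E x0 n)"
    by (rule finite_subset[of _ "Pow (U n)"]) (auto simp: volume_edges_def finite_volume)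
  have finP: "finite ?P"
    using finite_sphere finite_successors by (auto simp: sphere_def)
  \<comment> \<open>The levels tell parent from child, so the unordered edge determines the
    pair.\<close>
  have inj: "inj_on (\<lambda>(x, y). {x, y}) ?P"
    by (auto simp: inj_on_def sphere_def successors_iff doubleton_eq_iff)
  have disj: "volume_edges V E x0 n \<inter> (\<lambda>(x, y). {x, y}) ` ?P = {}"
    by (auto simp: volume_edges_def volume_iff sphere_def successors_iff)
  have old: "?f ?\<tau> e = ?f \<sigma> e" if "e \<in> volume_edges V E x0 n" for e
  proof -
    have "?\<tau> z = \<sigma> z" if "z \<in> e" for z
      using that \<open>e \<in> _\<close> volume_sphere_disjoint[of n]
      by (auto simp: volume_edges_def override_on_def)
    then have "(\<exists>x y. e = {x, y} \<and> x \<noteq> y \<and> ?\<tau> x = ?\<tau> y) \<longleftrightarrow> (\<exists>x y. e = {x, y} \<and> x \<noteq> y \<and> \<sigma> x = \<sigma> y)"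
      by (metis insertI1 insertI2)
    then show ?thesis by simp
  qed
  have new: "?f ?\<tau> {x, y} = of_bool (\<sigma> x = \<omega> y)" if "x \<in> W n" "y \<in> S x" for x y
  proof -
    have "y \<in> W (Suc n)" "x \<notin> W (Suc n)" "x \<noteq> y"
      using that by (auto simp: sphere_Suc) (auto simp: sphere_def successors_iff)
    then have "?\<tau> x = \<sigma> x" "?\<tau> y = \<omega> y" by simp_all
    then have "(\<exists>a b. {x, y} = {a, b} \<and> a \<noteq> b \<and> ?\<tau> a = ?\<tau> b) \<longleftrightarrow> \<sigma> x = \<omega> y"
      using \<open>x \<noteq> y\<close> by (metis doubleton_eq_iff)
    then show ?thesis by simp
  qed
  have "(\<Sum>e\<in>volume_edges V E x0 (Suc n). ?f ?\<tau> e)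
      = (\<Sum>e\<in>volume_edges V E x0 n. ?f ?\<tau> e) + (\<Sum>(x, y)\<in>?P. ?f ?\<tau> {x, y})"
    unfolding volume_edges_Suc[OF assms]
    by (subst sum.union_disjoint[OF fin finite_imageI[OF finP] disj], subst sum.reindex[OF inj])
       (simp add: case_prod_unfold comp_def)
  also have "(\<Sum>(x, y)\<in>?P. ?f ?\<tau> {x, y}) = (\<Sum>x\<in>W n. \<Sum>y\<in>S x. ?f ?\<tau> {x, y})"
    by (rule sum.Sigma[symmetric]) (use finite_sphere finite_successors in \<open>auto simp: sphere_def\<close>)
  also have "\<dots> = (\<Sum>x\<in>W n. \<Sum>y\<in>S x. of_bool (\<sigma> x = \<omega> y))"
    by (intro sum.cong refl new)
  also have "(\<Sum>e\<in>volume_edges V E x0 n. ?f ?\<tau> e) = (\<Sum>e\<in>volume_edges V E x0 n. ?f \<sigma> e)"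
    by (intro sum.cong refl old)
  finally show ?thesis by (simp only: hamiltonian_def distrib_left)
qed

end

section \<open>Edge factors: the Potts transfer matrix (\<open>\<theta>\<close> on the diagonal, 1
  elsewhere) applied to a boundary vector\<close>

definition edge_sum :: "nat \<Rightarrow> 'a::field \<Rightarrow> (nat \<Rightarrow> 'a) \<Rightarrow> nat \<Rightarrow> 'a" where
  "edge_sum q \<theta> u i = (\<Sum>j\<in>{0..q}. (if i = j then \<theta> else 1) * u j)"

lemma edge_sum_eq:
  assumes "i \<le> q"
  shows "edge_sum q \<theta> u i = (\<theta> - 1) * u i + (\<Sum>j=0..q. u j)"
proof -
  have "edge_sum q \<theta> u i = (\<Sum>j\<in>{0..q}. (if j = i then (\<theta> - 1) * u j else 0) + u j)"
    unfolding edge_sum_def by (rule sum.cong) (auto simp: algebra_simps)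
  then show ?thesis using assms by (simp add: sum.distrib)
qed

text \<open>Factoring out \<open>h y 0\<close> normalises coordinate 0 to 1. That coordinate
  supplies the \<open>\<theta>\<close> in the denominator of \<open>potts_F\<close> and the 1 in its
  numerator.\<close>

lemma edge_sum_h_hat:
  assumes "h y 0 \<noteq> 0"
  shows "edge_sum q \<theta> (h y) 0 = h y 0 * ((\<Sum>j=1..q. h_hat h y j) + \<theta>)"
    and "1 \<le> i \<Longrightarrow> i \<le> q \<Longrightarrow>
      edge_sum q \<theta> (h y) i = h y 0 * ((\<theta> - 1) * h_hat h y i + (\<Sum>j=1..q. h_hat h y j) + 1)"
proof -
  have "(\<Sum>j=1..q. h_hat h y j) = (\<Sum>j=1..q. h y j) / h y 0"
    by (simp add: h_hat_def sum_divide_distrib)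
  moreover have "(\<Sum>j=0..q. h y j) = h y 0 + (\<Sum>j=1..q. h y j)"
    by (simp add: sum.atLeast_Suc_atMost)
  ultimately show "edge_sum q \<theta> (h y) 0 = h y 0 * ((\<Sum>j=1..q. h_hat h y j) + \<theta>)"
    and "1 \<le> i \<Longrightarrow> i \<le> q \<Longrightarrow>
      edge_sum q \<theta> (h y) i = h y 0 * ((\<theta> - 1) * h_hat h y i + (\<Sum>j=1..q. h_hat h y j) + 1)"
    using assms by (simp_all add: edge_sum_eq h_hat_def field_simps)
qed

text \<open>The common factor \<open>h y 0\<close> cancels. If the denominator vanishes, both
  quotients are 0.\<close>

lemma potts_F_eq:
  assumes "h y 0 \<noteq> 0" "1 \<le> i" "i \<le> q"
  shows "potts_F q (h_hat h y) \<theta> i = edge_sum q \<theta> (h y) i / edge_sum q \<theta> (h y) 0"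
  using assms by (simp add: edge_sum_h_hat potts_F_def)

section \<open>Finite sums and products over configurations\<close>

lemma power_int_sum:
  fixes \<theta> :: "'a::field"
  assumes "\<theta> \<noteq> 0" "finite A"
  shows "\<theta> powi (\<Sum>x\<in>A. f x) = (\<Prod>x\<in>A. \<theta> powi f x)"
  using assms(2,1) by (induction A rule: finite_induct) (auto simp: power_int_add)

text \<open>Restriction to \<open>A\<close> and \<open>B\<close> is inverse to gluing: disjointness
  keeps gluing from overwriting values on \<open>A\<close>, and extensionality fixes the values
  outside.\<close>

lemma sum_configs_Un:
  assumes "A \<inter> B = {}"
  shows "(\<Sum>\<tau>\<in>configs q (A \<union> B). f \<tau>)
    = (\<Sum>\<sigma>\<in>configs q A. \<Sum>\<omega>\<in>configs q B. f (override_on \<sigma> \<omega> B))"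
proof -
  have "(\<Sum>\<tau>\<in>configs q (A \<union> B). f \<tau>)
      = (\<Sum>(\<sigma>, \<omega>)\<in>configs q A \<times> configs q B. f (override_on \<sigma> \<omega> B))"
  proof (rule sum.reindex_bij_witness[where i = "\<lambda>(\<sigma>, \<omega>). override_on \<sigma> \<omega> B"
        and j = "\<lambda>\<tau>. (restrict \<tau> A, restrict \<tau> B)"])
    fix \<tau> assume \<tau>: "\<tau> \<in> configs q (A \<union> B)"
    show "(case (restrict \<tau> A, restrict \<tau> B) of (\<sigma>, \<omega>) \<Rightarrow> override_on \<sigma> \<omega> B) = \<tau>"
      using \<tau> by (auto simp: configs_def override_on_def fun_eq_iff restrict_def PiE_def extensional_def)
    then show "(case (restrict \<tau> A, restrict \<tau> B) of (\<sigma>, \<omega>) \<Rightarrow> f (override_on \<sigma> \<omega> B)) = f \<tau>"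
      by simp
    show "(restrict \<tau> A, restrict \<tau> B) \<in> configs q A \<times> configs q B"
      using \<tau> by (auto simp: configs_def PiE_def)
  next
    fix b assume "b \<in> configs q A \<times> configs q B"
    then show "(restrict (case b of (\<sigma>, \<omega>) \<Rightarrow> override_on \<sigma> \<omega> B) A,
        restrict (case b of (\<sigma>, \<omega>) \<Rightarrow> override_on \<sigma> \<omega> B) B) = b"
      and "(case b of (\<sigma>, \<omega>) \<Rightarrow> override_on \<sigma> \<omega> B) \<in> configs q (A \<union> B)"
      using assms
      by (auto simp: configs_def override_on_def fun_eq_iff restrict_def PiE_def extensional_def Pi_def)
  qed
  then show ?thesis by (simp add: sum.cartesian_product)
qed

text \<open>Assignments that are 0 except at \<open>x\<close> isolate the factor at
  \<open>x\<close>; the contribution of the other vertices is the same for every spin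
  \<open>i\<close> and cancels on comparison with spin 0.\<close>

lemma proportional_products_imp_ratio:
  fixes f g :: "'v \<Rightarrow> nat \<Rightarrow> 'a::field"
  assumes W: "finite W" and f0: "\<And>x. x \<in> W \<Longrightarrow> f x 0 \<noteq> 0" and ab: "a \<noteq> 0"
    and eq: "\<And>s. s \<in> W \<rightarrow> {0..q} \<Longrightarrow> b * (\<Prod>x\<in>W. g x (s x)) = a * (\<Prod>x\<in>W. f x (s x))"
    and x: "x \<in> W"
  shows "g x 0 \<noteq> 0" and "i \<le> q \<Longrightarrow> f x i / f x 0 = g x i / g x 0"
proof -
  let ?G = "\<Prod>z\<in>W - {x}. g z 0" and ?F = "\<Prod>z\<in>W - {x}. f z 0"
  have key: "b * (g x i * ?G) = a * (f x i * ?F)" if "i \<le> q" for i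
  proof -
    let ?s = "(\<lambda>_. 0)(x := i)"
    have "(\<Prod>z\<in>W. g z (?s z)) = g x i * ?G" "(\<Prod>z\<in>W. f z (?s z)) = f x i * ?F"
      using prod.remove[OF W x, of "\<lambda>z. g z (?s z)"] prod.remove[OF W x, of "\<lambda>z. f z (?s z)"]
      by auto
    then show ?thesis using eq[of ?s] that by (auto simp: Pi_def)
  qed
  have F: "?F \<noteq> 0" using W f0 by simp
  \<comment> \<open>At spin 0 the right-hand side of \<open>key\<close> is a product of nonzero
    factors, so every factor on the left is nonzero too.\<close>
  have "b * (g x 0 * ?G) \<noteq> 0" using key[of 0] F ab f0[OF x] by simp
  then show g0: "g x 0 \<noteq> 0" by auto
  have G: "b * ?G \<noteq> 0" using \<open>b * (g x 0 * ?G) \<noteq> 0\<close> by auto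
  show "f x i / f x 0 = g x i / g x 0" if "i \<le> q"
  proof -
    \<comment> \<open>Multiply \<open>key\<close> at \<open>i\<close> crosswise with
      \<open>key\<close> at 0, then cancel the common nonzero factor.\<close>
    have "(f x i * g x 0) * (a * ?F * (b * ?G)) = (a * (f x i * ?F)) * (b * (g x 0 * ?G))"
      by (simp add: mult_ac)
    also have "\<dots> = (b * (g x i * ?G)) * (a * (f x 0 * ?F))" using key[OF that] key[of 0] by simp
    also have "\<dots> = (g x i * f x 0) * (a * ?F * (b * ?G))" by (simp add: mult_ac)
    finally have "f x i * g x 0 = g x i * f x 0" using F G ab by simp
    then show ?thesis using g0 f0[OF x] by (simp add: frac_eq_eq)
  qed
qed

section \<open>Summing out the outermost sphere\<close>

locale potts_model = potts_tree k V E x0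
  for k :: nat and V :: "'v set" and E :: "'v set set" and x0 :: 'v +
  fixes q :: nat and N :: int and \<theta> :: "'p::prime_card padic" and h :: "'v \<Rightarrow> nat \<Rightarrow> 'p padic"
  assumes theta: "\<theta> = of_nat CARD('p) powi N"
    and h0: "\<And>x. x \<in> V - {x0} \<Longrightarrow> h x 0 \<noteq> 0"
    and Z: "\<And>n. n \<ge> 1 \<Longrightarrow> partition_fun N q V E x0 h n \<noteq> 0"
begin

abbreviation boltzmann where
  "boltzmann n \<sigma> \<equiv> of_nat CARD('p) powi hamiltonian N V E x0 n \<sigma> :: 'p padic"
abbreviation Zn where "Zn \<equiv> partition_fun N q V E x0 h"
abbreviation G where "G y \<equiv> edge_sum q \<theta> (h y)"

lemma theta_nonzero: "\<theta> \<noteq> 0"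
  by (simp add: theta)

lemma h0_sphere: "n \<ge> 1 \<Longrightarrow> x \<in> W n \<Longrightarrow> h x 0 \<noteq> 0"
  using h0 sphere_minus_root by blast

lemma h0_successor: "y \<in> S x \<Longrightarrow> h y 0 \<noteq> 0"
  using h0[of y] edge_in(2)[of x y] level_root by (cases "y = x0") (auto simp: successors_iff)

text \<open>Each vertex of the new sphere has exactly one edge to the old volume, so the weight of
  that edge can be grouped with the boundary value at the vertex.\<close>

lemma gibbs_weight_Suc:
  assumes "n \<ge> 1"
  shows "gibbs_weight N V E x0 h (Suc n) (override_on \<sigma> \<omega> (W (Suc n)))
    = boltzmann n \<sigma> * (\<Prod>x\<in>W n. \<Prod>y\<in>S x. (if \<sigma> x = \<omega> y then \<theta> else 1) * h y (\<omega> y))"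
proof -
  let ?m = "\<Sum>x\<in>W n. \<Sum>y\<in>S x. of_bool (\<sigma> x = \<omega> y) :: int"
  have "(of_nat CARD('p) :: 'p padic) powi (N * ?m) = \<theta> powi ?m"
    by (simp add: theta power_int_mult)
  also have "\<dots> = (\<Prod>x\<in>W n. \<theta> powi (\<Sum>y\<in>S x. of_bool (\<sigma> x = \<omega> y)))"
    by (rule power_int_sum[OF theta_nonzero finite_sphere])
  also have "\<dots> = (\<Prod>x\<in>W n. \<Prod>y\<in>S x. \<theta> powi of_bool (\<sigma> x = \<omega> y))"
    by (intro prod.cong refl power_int_sum[OF theta_nonzero] finite_successors)
       (simp add: sphere_def)
  also have "\<dots> = (\<Prod>x\<in>W n. \<Prod>y\<in>S x. if \<sigma> x = \<omega> y then \<theta> else 1)"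
    by (intro prod.cong refl) auto
  finally have "boltzmann (Suc n) (override_on \<sigma> \<omega> (W (Suc n)))
      = boltzmann n \<sigma> * (\<Prod>x\<in>W n. \<Prod>y\<in>S x. if \<sigma> x = \<omega> y then \<theta> else 1)"
    by (simp add: hamiltonian_Suc[OF assms] power_int_add)
  moreover have "(\<Prod>y\<in>W (Suc n). h y (override_on \<sigma> \<omega> (W (Suc n)) y)) = (\<Prod>x\<in>W n. \<Prod>y\<in>S x. h y (\<omega> y))"
    unfolding prod_sphere_Suc[symmetric] by (rule prod.cong) auto
  ultimately show ?thesis by (simp add: gibbs_weight_def prod.distrib)
qed

lemma sum_gibbs_weight:
  assumes "n \<ge> 1"
  shows "(\<Sum>\<omega>\<in>configs q (W (Suc n)). gibbs_weight N V E x0 h (Suc n) (override_on \<sigma> \<omega> (W (Suc n))))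
    = boltzmann n \<sigma> * (\<Prod>x\<in>W n. \<Prod>y\<in>S x. G y (\<sigma> x))"
proof -
  \<comment> \<open>Naming the parent makes each factor a function of \<open>y\<close> and
    \<open>\<omega> y\<close> alone, so the sum over \<open>\<omega>\<close> can be exchanged with
    the product over the whole sphere by \<open>prod_sum_PiE\<close>.\<close>
  define par where "par y = (THE x. y \<in> S x)" for y
  have par: "par y = x" if "y \<in> S x" for x y
    unfolding par_def using that successors_disjoint by blast
  let ?f = "\<lambda>y j. (if \<sigma> (par y) = j then \<theta> else 1) * h y j"
  have "(\<Sum>\<omega>\<in>configs q (W (Suc n)). \<Prod>x\<in>W n. \<Prod>y\<in>S x. (if \<sigma> x = \<omega> y then \<theta> else 1) * h y (\<omega> y))
      = (\<Sum>\<omega>\<in>configs q (W (Suc n)). \<Prod>y\<in>W (Suc n). ?f y (\<omega> y))"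
    unfolding prod_sphere_Suc by (intro sum.cong prod.cong refl) (simp add: par)
  also have "\<dots> = (\<Prod>y\<in>W (Suc n). \<Sum>j\<in>{0..q}. ?f y j)"
    unfolding configs_def by (rule prod_sum_PiE[symmetric]) (auto simp: finite_sphere)
  also have "\<dots> = (\<Prod>x\<in>W n. \<Prod>y\<in>S x. G y (\<sigma> x))"
    unfolding prod_sphere_Suc edge_sum_def by (intro prod.cong refl) (simp add: par)
  finally show ?thesis by (simp add: gibbs_weight_Suc[OF assms] sum_distrib_left[symmetric])
qed

lemma partition_fun_Suc:
  assumes "n \<ge> 1"
  shows "Zn (Suc n) = (\<Sum>\<sigma>\<in>configs q (U n). boltzmann n \<sigma> * (\<Prod>x\<in>W n. \<Prod>y\<in>S x. G y (\<sigma> x)))"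
  unfolding partition_fun_def volume_Suc sum_configs_Un[OF volume_sphere_disjoint]
  by (simp add: sum_gibbs_weight[OF assms])

lemma compatible_iff:
  "compatible N q V E x0 h \<longleftrightarrow> (\<forall>n\<ge>1. \<forall>\<sigma>\<in>configs q (U n).
     Zn n * (\<Prod>x\<in>W n. \<Prod>y\<in>S x. G y (\<sigma> x)) = Zn (Suc n) * (\<Prod>x\<in>W n. h x (\<sigma> x)))"
proof -
  have "(\<Sum>\<omega>\<in>configs q (W (Suc n)). gibbs_measure N q V E x0 h (Suc n) (override_on \<sigma> \<omega> (W (Suc n))))
      = gibbs_measure N q V E x0 h n \<sigma> \<longleftrightarrow>
     Zn n * (\<Prod>x\<in>W n. \<Prod>y\<in>S x. G y (\<sigma> x)) = Zn (Suc n) * (\<Prod>x\<in>W n. h x (\<sigma> x))"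
    (is "?L n \<sigma> \<longleftrightarrow> ?R n \<sigma>") if n: "n \<ge> 1" for n \<sigma>
  proof -
    \<comment> \<open>The Boltzmann factor of \<open>\<sigma>\<close> occurs on both sides and
      cancels; cross-multiplying by the nonzero partition functions gives the product form.\<close>
    have b: "boltzmann n \<sigma> \<noteq> 0" by simp
    have "(\<Sum>\<omega>\<in>configs q (W (Suc n)). gibbs_measure N q V E x0 h (Suc n) (override_on \<sigma> \<omega> (W (Suc n))))
      = boltzmann n \<sigma> * (\<Prod>x\<in>W n. \<Prod>y\<in>S x. G y (\<sigma> x)) / Zn (Suc n)"
      by (simp add: gibbs_measure_def sum_divide_distrib[symmetric] sum_gibbs_weight[OF n])
    moreover have "gibbs_measure N q V E x0 h n \<sigma> = boltzmann n \<sigma> * (\<Prod>x\<in>W n. h x (\<sigma> x)) / Zn n"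
      by (simp add: gibbs_measure_def gibbs_weight_def)
    ultimately show ?thesis using b Z[OF n] Z[of "Suc n"] by (simp add: frac_eq_eq mult_ac)
  qed
  then have "(\<forall>n\<ge>1. \<forall>\<sigma>\<in>configs q (U n). ?L n \<sigma>)
      \<longleftrightarrow> (\<forall>n\<ge>1. \<forall>\<sigma>\<in>configs q (U n). ?R n \<sigma>)" by blast
  \<comment> \<open>Index shift from the pair \<open>n\<close>, \<open>n - 1\<close> in
    \<open>compatible\<close> to \<open>Suc n\<close>, \<open>n\<close>.\<close>
  moreover have "(\<forall>n\<ge>2. P n (n - 1)) \<longleftrightarrow> (\<forall>n\<ge>1. P (Suc n) n)" for P :: "nat \<Rightarrow> nat \<Rightarrow> bool"
    by (metis One_nat_def Suc_1 Suc_le_D Suc_le_mono diff_Suc_1)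
  from this[of "\<lambda>n m. \<forall>\<sigma>\<in>configs q (U m).
      (\<Sum>\<omega>\<in>configs q (W n). gibbs_measure N q V E x0 h n (override_on \<sigma> \<omega> (W n)))
        = gibbs_measure N q V E x0 h m \<sigma>"]
  have "compatible N q V E x0 h \<longleftrightarrow> (\<forall>n\<ge>1. \<forall>\<sigma>\<in>configs q (U n). ?L n \<sigma>)"
    unfolding compatible_def .
  ultimately show ?thesis by (rule trans[rotated])
qed

section \<open>From compatibility to the recursion and back\<close>

lemma compatible_imp_recursion:
  assumes "compatible N q V E x0 h" "n \<ge> 1" "x \<in> W n"
  shows "(\<Prod>y\<in>S x. G y 0) \<noteq> 0"
    and "i \<le> q \<Longrightarrow> h_hat h x i = (\<Prod>y\<in>S x. G y i) / (\<Prod>y\<in>S x. G y 0)"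
proof -
  \<comment> \<open>Both sides see only the spins on \<open>W n\<close>, so an arbitrary assignment
    there is extended by 0 to the whole volume.\<close>
  have eq: "Zn n * (\<Prod>x\<in>W n. \<Prod>y\<in>S x. G y (s x)) = Zn (Suc n) * (\<Prod>x\<in>W n. h x (s x))"
    if s: "s \<in> W n \<rightarrow> {0..q}" for s
  proof -
    let ?\<sigma> = "\<lambda>x\<in>U n. if x \<in> W n then s x else 0"
    have \<sigma>: "?\<sigma> \<in> configs q (U n)" using s by (auto simp: configs_def)
    have "?\<sigma> x = s x" if "x \<in> W n" for x
      using that sphere_subset_volume[OF assms(2)] by auto
    then have on_W: "(\<Prod>x\<in>W n. \<Prod>y\<in>S x. G y (?\<sigma> x)) = (\<Prod>x\<in>W n. \<Prod>y\<in>S x. G y (s x))"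
      "(\<Prod>x\<in>W n. h x (?\<sigma> x)) = (\<Prod>x\<in>W n. h x (s x))"
      by (auto intro!: prod.cong)
    have "Zn n * (\<Prod>x\<in>W n. \<Prod>y\<in>S x. G y (?\<sigma> x)) = Zn (Suc n) * (\<Prod>x\<in>W n. h x (?\<sigma> x))"
      using assms(1)[unfolded compatible_iff, rule_format, OF assms(2) \<sigma>] .
    then show ?thesis unfolding on_W .
  qed
  have nz: "Zn (Suc n) \<noteq> 0" by (rule Z) simp
  note ratio = proportional_products_imp_ratio[where g = "\<lambda>x i. \<Prod>y\<in>S x. G y i" and f = h,
      OF finite_sphere h0_sphere[OF assms(2)] nz eq assms(3)]
  show "(\<Prod>y\<in>S x. G y 0) \<noteq> 0" by (rule ratio(1))
  show "h_hat h x i = (\<Prod>y\<in>S x. G y i) / (\<Prod>y\<in>S x. G y 0)" if "i \<le> q"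
    unfolding h_hat_def by (rule ratio(2)[OF _ _ that])
qed

lemma recursion_imp_compatible:
  assumes G0: "\<And>n x. n \<ge> 1 \<Longrightarrow> x \<in> W n \<Longrightarrow> (\<Prod>y\<in>S x. G y 0) \<noteq> 0"
    and rec: "\<And>n x i. n \<ge> 1 \<Longrightarrow> x \<in> W n \<Longrightarrow> 1 \<le> i \<Longrightarrow> i \<le> q \<Longrightarrow>
      h_hat h x i = (\<Prod>y\<in>S x. G y i) / (\<Prod>y\<in>S x. G y 0)"
  shows "compatible N q V E x0 h"
  unfolding compatible_iff
proof (intro allI impI ballI)
  fix n \<sigma> assume n: "(1::nat) \<le> n" and \<sigma>: "\<sigma> \<in> configs q (U n)"
  \<comment> \<open>The proportionality constant is read off at spin 0, where each vertex
    contributes a ratio independent of the configuration.\<close>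
  define C where "C = (\<Prod>x\<in>W n. (\<Prod>y\<in>S x. G y 0) / h x 0)"
  have factor: "(\<Prod>y\<in>S x. G y i) = (\<Prod>y\<in>S x. G y 0) / h x 0 * h x i" if "x \<in> W n" "i \<le> q" for x i
  \<comment> \<open>The recursion speaks of spins from 1 on; at spin 0 the identity is the
    cancellation of \<open>h x 0\<close>.\<close>
  proof (cases "i = 0")
    case True
    then show ?thesis using h0_sphere[OF n that(1)] by simp
  next
    case False
    then show ?thesis
      using rec[OF n that(1) _ that(2)] G0[OF n that(1)] h0_sphere[OF n that(1)]
      by (simp add: h_hat_def field_simps)
  qed
  have factored: "(\<Prod>x\<in>W n. \<Prod>y\<in>S x. G y (\<tau> x)) = C * (\<Prod>x\<in>W n. h x (\<tau> x))" if "\<tau> \<in> configs q (U n)" for \<tau>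
  proof -
    have "\<tau> x \<le> q" if "x \<in> W n" for x
      using that \<open>\<tau> \<in> _\<close> sphere_subset_volume[OF n] by (force simp: configs_def PiE_iff)
    then show ?thesis unfolding C_def prod.distrib[symmetric]
      by (intro prod.cong refl factor)
  qed
  \<comment> \<open>Restoring the Boltzmann factor turns each summand of
    \<open>partition_fun_Suc\<close> into \<open>C\<close> times a Gibbs weight on
    \<open>U n\<close>.\<close>
  have "Zn (Suc n) = (\<Sum>\<tau>\<in>configs q (U n). C * gibbs_weight N V E x0 h n \<tau>)"
    unfolding partition_fun_Suc[OF n]
    by (rule sum.cong) (simp_all add: factored gibbs_weight_def mult_ac)
  then have "Zn (Suc n) = C * Zn n"
    by (simp add: partition_fun_def sum_distrib_left)
  then show "Zn n * (\<Prod>x\<in>W n. \<Prod>y\<in>S x. G y (\<sigma> x)) = Zn (Suc n) * (\<Prod>x\<in>W n. h x (\<sigma> x))"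
    by (simp add: factored[OF \<sigma>])
qed

text \<open>Since \<open>h y 0\<close> is nonzero, \<open>G y 0\<close> vanishes exactly when the
  denominator of \<open>potts_F\<close> at \<open>y\<close> does, and a finite product in a field is
  nonzero iff all its factors are.\<close>

lemma denominators_nonzero_iff:
  assumes "x \<in> V"
  shows "(\<forall>y\<in>S x. (\<Sum>j=1..q. h_hat h y j) + \<theta> \<noteq> 0) \<longleftrightarrow> (\<Prod>y\<in>S x. G y 0) \<noteq> 0"
  using finite_successors[OF assms] h0_successor by (auto simp: edge_sum_h_hat)

lemma prod_potts_F:
  assumes "1 \<le> i" "i \<le> q"
  shows "(\<Prod>y\<in>S x. potts_F q (h_hat h y) \<theta> i) = (\<Prod>y\<in>S x. G y i) / (\<Prod>y\<in>S x. G y 0)"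
  unfolding prod_dividef[symmetric]
  by (intro prod.cong refl potts_F_eq h0_successor assms)

end

theorem theorem3p1:
  fixes k q :: nat and N :: int and \<theta> :: "'p::prime_card padic"
    and V :: "'v set" and E :: "'v set set" and x0 :: 'v
    and h :: "'v \<Rightarrow> nat \<Rightarrow> 'p padic"
  assumes "k \<ge> 1" and "q \<ge> 1" and "N \<noteq> 0"
    and "\<theta> = of_nat CARD('p) powi N"
    and "cayley_tree k V E x0"
    and "\<forall>x\<in>V - {x0}. h x 0 \<noteq> 0"
    and "\<forall>n\<ge>1. partition_fun N q V E x0 h n \<noteq> 0"
  shows "compatible N q V E x0 h \<longleftrightarrow>
    (\<forall>n\<ge>1. \<forall>x\<in>sphere V E x0 n.
       (\<forall>y\<in>successors E x0 x. (\<Sum>j=1..q. h_hat h y j) + \<theta> \<noteq> 0) \<and>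
       (\<forall>i\<in>{1..q}. h_hat h x i = (\<Prod>y\<in>successors E x0 x. potts_F q (h_hat h y) \<theta> i)))"
proof -
  interpret potts_model k V E x0 q N \<theta> h
    using assms by unfold_locales auto
  \<comment> \<open>The equivalence is first proved for quotients of edge factors, with the
    nonvanishing at spin 0 as a conjunct that becomes the condition on the denominators.\<close>
  have "compatible N q V E x0 h \<longleftrightarrow> (\<forall>n\<ge>1. \<forall>x\<in>W n. (\<Prod>y\<in>S x. G y 0) \<noteq> 0 \<and>
      (\<forall>i\<in>{1..q}. h_hat h x i = (\<Prod>y\<in>S x. G y i) / (\<Prod>y\<in>S x. G y 0)))" (is "_ \<longleftrightarrow> ?R")
  proof
    show ?R if "compatible N q V E x0 h"
      using compatible_imp_recursion[OF that] by auto
    show "compatible N q V E x0 h" if ?R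
      by (rule recursion_imp_compatible) (use that in auto)
  qed
  also have "?R \<longleftrightarrow> (\<forall>n\<ge>1. \<forall>x\<in>W n.
       (\<forall>y\<in>S x. (\<Sum>j=1..q. h_hat h y j) + \<theta> \<noteq> 0) \<and>
       (\<forall>i\<in>{1..q}. h_hat h x i = (\<Prod>y\<in>S x. potts_F q (h_hat h y) \<theta> i)))"
    using denominators_nonzero_iff prod_potts_F by (auto simp: sphere_def)
  finally show ?thesis .
qed

end
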